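(* Let $d\geqslant2$ and let $\Phi=[\Phi_{i,j}]_{(i,j)\in\{1,\ldots,d\}^2}\in L^1_{\mathrm{loc}}(\mathbb{R}_+,\mathbb{M}_d)$ be such that $\Phi_{i,j}\in\mathscr{R}_0(\alpha_{i,j})$ for some $\alpha_{i,j}>-1$, for all $(i,j)\in\{1,\ldots,d\}^2$. Define $$\alpha^{\pm}=\min\big\{\alpha_{1,\sigma(1)}+\cdots+\alpha_{d,\sigma(d)}:\sigma\in S_d,\ \mathrm{sgn}(\sigma)=\pm1\big\}.$$ If $\alpha^+\neq\alpha^-$, then $0\in\operatorname{ess\,supp}\,\mathrm{det}^*(\Phi)$.
   Context: $\mathbb{R}_+=[0,\infty)$; $\mathbb{M}_d$ is the space of real $d\times d$ matrices; $L^1_{\mathrm{loc}}(\mathbb{R}_+,\mathbb{M}_d)$ is the set of measurable $G:\mathbb{R}_+\to\mathbb{M}_d$ whose entries satisfy $\int_0^t|G_{i,j}(u)|\mathrm{d}u<\infty$ for all $t\geqslant0$. $S_d$ is the group of permutations of $\{1,\dots,d\}$ and $\mathrm{sgn}$ the signature. $\mathscr{R}_0(\alpha)$, $\alpha\in\mathbb{R}$, is the set of functions regularly varying at zero with index $\alpha$: measurable $f:\mathbb{R}_+\to\mathbb{R}_+$ with $\lim_{t\to0+}f(\ell t)/f(t)=\ell^\alpha$ for all $\ell>0$ (so $f(t)>0$ for all sufficiently small $t>0$). Convolution: $(g*h)(t)=\int_0^tg(t-u)h(u)\mathrm{d}u$. Convolution determinant: $\mathrm{det}^*(\Phi)(t)=\sum_{\sigma\in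 S_d}\mathrm{sgn}(\sigma)\big(\Phi_{1,\sigma(1)}*\cdots*\Phi_{d,\sigma(d)}\big)(t)$, $t\geqslant0$. The essential support $\operatorname{ess\,supp}f$ of a function $f$ on $\mathbb{R}_+$ (extended by $0$ to $\mathbb{R}$) is the smallest closed subset of $\mathbb{R}$ such that $f=0$ almost everywhere in its complement. *)

theory Defs
  imports "HOL-Analysis.Analysis" "HOL-Combinatorics.Permutations"
begin

text \<open>
  Functions on \<open>[0, \<infinity>)\<close> are represented by functions on \<open>real\<close> whose values at negative
  arguments are irrelevant. A function \<open>\<Phi>\<close> with values in the real \<open>d \<times> d\<close> matrices is represented
  by its entries \<open>\<Phi> i j :: real \<Rightarrow> real\<close> for \<open>i, j \<in> {1..d}\<close>; other indices are
  irrelevant. The numerical indexing fixes the order of the factors in the convolution determinant.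
  Measurability and integration are in the sense of Lebesgue.
\<close>

definition L1_loc :: "nat \<Rightarrow> (nat \<Rightarrow> nat \<Rightarrow> real \<Rightarrow> real) set" where
  "L1_loc d = {G. \<forall>i\<in>{1..d}. \<forall>j\<in>{1..d}.
     G i j \<in> borel_measurable (lebesgue_on {0..}) \<and>
     (\<forall>t\<ge>0. set_integrable lebesgue {0..t} (G i j))}"

text \<open>
  Since \<open>l powr \<alpha> > 0\<close> and \<open>x / 0 = 0\<close>, the limit below forces \<open>f t > 0\<close> for all sufficiently
  small \<open>t > 0\<close>, so the quotients are genuine near \<open>0\<close>.
\<close>

definition RV0 :: "real \<Rightarrow> (real \<Rightarrow> real) set" where
  "RV0 \<alpha> = {f. f \<in> borel_measurable (lebesgue_on {0..}) \<and> (\<forall>t\<ge>0. 0 \<le> f t) \<and>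
     (\<forall>l>0. ((\<lambda>t. f (l * t) / f t) \<longlongrightarrow> l powr \<alpha>) (at_right 0))}"

text \<open>
  The convolution of two locally integrable functions converges for almost every \<open>t \<ge> 0\<close>; at the
  remaining points the Bochner integral is \<open>0\<close> by convention. Iterated convolutions, being integrals,
  do not depend on values on null sets, and neither does the essential support.
\<close>

definition convolve :: "(real \<Rightarrow> real) \<Rightarrow> (real \<Rightarrow> real) \<Rightarrow> real \<Rightarrow> real" where
  "convolve g h t = (LINT u:{0..t}|lebesgue. g (t - u) * h u)"

text \<open>
  \<open>conv_prod f d\<close> is \<open>f 1 * \<dots> * f d\<close>, associated to the left, for \<open>d \<ge> 1\<close>. The value for \<open>d = 0\<close>
  is meaningless, as convolution has no neutral element among functions.
\<close>

definition conv_prod :: "(nat \<Rightarrow> real \<Rightarrow> real) \<Rightarrow> nat \<Rightarrow> real \<Rightarrow> real" where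
  "conv_prod f d = foldl convolve (f 1) (map f [2..<Suc d])"

definition conv_det :: "nat \<Rightarrow> (nat \<Rightarrow> nat \<Rightarrow> real \<Rightarrow> real) \<Rightarrow> real \<Rightarrow> real" where
  "conv_det d \<Phi> t =
     (\<Sum>\<sigma> | \<sigma> permutes {1..d}. of_int (sign \<sigma>) * conv_prod (\<lambda>i. \<Phi> i (\<sigma> i)) d t)"

definition zero_extension :: "(real \<Rightarrow> real) \<Rightarrow> real \<Rightarrow> real" where
  "zero_extension f t = (if 0 \<le> t then f t else 0)"

definition ess_supp :: "(real \<Rightarrow> real) \<Rightarrow> real set" where
  "ess_supp f = \<Inter> {S. closed S \<and> (AE t in lebesgue. t \<notin> S \<longrightarrow> zero_extension f t = 0)}"

text \<open>The intersection is itself a member of the family, hence its least element.\<close>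

lemma ess_supp_smallest:
  "closed (ess_supp f)"
  "AE t in lebesgue. t \<notin> ess_supp f \<longrightarrow> zero_extension f t = 0"
  "closed S \<Longrightarrow> (AE t in lebesgue. t \<notin> S \<longrightarrow> zero_extension f t = 0) \<Longrightarrow> ess_supp f \<subseteq> S"
proof -
  let ?F = "{S. closed S \<and> (AE t in lebesgue. t \<notin> S \<longrightarrow> zero_extension f t = 0)}"
  show "closed (ess_supp f)"
    unfolding ess_supp_def by (rule closed_Inter) auto
  show "ess_supp f \<subseteq> S"
    if "closed S" "AE t in lebesgue. t \<notin> S \<longrightarrow> zero_extension f t = 0" for S
    using that unfolding ess_supp_def by blast
  obtain \<G> where \<G>: "\<G> \<subseteq> uminus ` ?F" "countable \<G>" "\<Union>\<G> = \<Union>(uminus ` ?F)"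
    using Lindelof[of "uminus ` ?F"] by (auto simp: open_Compl)
  have "AE t in lebesgue. \<forall>U\<in>\<G>. t \<in> U \<longrightarrow> zero_extension f t = 0"
    using \<G>(1) by (subst AE_ball_countable[OF \<G>(2)]) auto
  moreover have "- ess_supp f = \<Union>\<G>"
    unfolding \<G>(3) ess_supp_def by auto
  ultimately show "AE t in lebesgue. t \<notin> ess_supp f \<longrightarrow> zero_extension f t = 0"
    by (elim AE_mp) (intro AE_I2, blast)
qed

text \<open>\<open>alpha_min d \<alpha> 1\<close> and \<open>alpha_min d \<alpha> (-1)\<close> are \<open>\<alpha>\<^sup>+\<close> and \<open>\<alpha>\<^sup>-\<close>; for \<open>d \<ge> 2\<close> both sets are nonempty.\<close>

definition alpha_min :: "nat \<Rightarrow> (nat \<Rightarrow> nat \<Rightarrow> real) \<Rightarrow> int \<Rightarrow> real" where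
  "alpha_min d \<alpha> s = Min {\<Sum>i\<in>{1..d}. \<alpha> i (\<sigma> i) | \<sigma>. \<sigma> permutes {1..d} \<and> sign \<sigma> = s}"

end

theory Submission
  imports Defs
begin

text \<open>
  Nonnegative functions satisfy \<open>\<integral>\<^sub>0\<^sup>s g \<cdot> \<integral>\<^sub>0\<^sup>t h \<le> \<integral>\<^sub>0\<^sup>s\<^sup>+\<^sup>t g * h\<close> and
  \<open>\<integral>\<^sub>0\<^sup>t g * h \<le> \<integral>\<^sub>0\<^sup>t g \<cdot> \<integral>\<^sub>0\<^sup>t h\<close>, since the triangle \<open>{u + v \<le> T}\<close> lies between
  two rectangles. So the primitive of each summand of the convolution determinant is comparable,
  up to a rescaling of the argument, to the product of the primitives of its factors. By the
  substitution \<open>u \<mapsto> u / 2\<close>, halving the argument multiplies the primitive of a function in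
  \<open>RV0 \<alpha>\<close> by a factor that tends to \<open>2 powr - (\<alpha> + 1)\<close>; neither Karamata's theorem nor
  uniform convergence is needed. If the determinant vanished near \<open>0\<close>, the summand attaining the
  smaller of \<open>\<alpha>\<^sup>+\<close> and \<open>\<alpha>\<^sup>-\<close> would be at most the sum of the summands of opposite sign; along
  \<open>t = 2\<^sup>-\<^sup>n\<close> the latter is of smaller order, a contradiction.
\<close>

section \<open>Nonnegative locally integrable functions\<close>

text \<open>Of the properties of the factors, this keeps what is carried through convolutions.
  Regular variation enters only through the primitives of the individual factors.\<close>

definition nonneg_L1_loc :: "(real \<Rightarrow> real) \<Rightarrow> bool" where
  "nonneg_L1_loc f \<longleftrightarrow> f \<in> borel_measurable (lebesgue_on {0..}) \<and> (\<forall>t\<ge>0. 0 \<le> f t) \<and>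
     (\<forall>t\<ge>0. set_integrable lebesgue {0..t} f)"

lemma nonneg_L1_loc_integrable_on:
  assumes "nonneg_L1_loc f" "0 \<le> t"
  shows "f integrable_on {0..t}"
  using assms unfolding nonneg_L1_loc_def by (auto intro: set_lebesgue_integral_eq_integral)

lemma nonneg_L1_loc_integral_nonneg:
  assumes "nonneg_L1_loc f"
  shows "0 \<le> integral {0..t} f"
  using assms nonneg_L1_loc_integrable_on[OF assms, of t] unfolding nonneg_L1_loc_def
  by (cases "0 \<le> t") (auto intro!: Henstock_Kurzweil_Integration.integral_nonneg)

text \<open>Links the gauge integral, in which the bounds are stated, to the nonnegative integral
  over \<open>lborel\<close>, where Tonelli's theorem is applied. Completing the measure leaves the
  nonnegative integral unchanged.\<close>

lemma nonneg_L1_loc_nn_integral: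
  assumes "nonneg_L1_loc f" "0 \<le> t"
  shows "(\<integral>\<^sup>+u\<in>{0..t}. ennreal (f u) \<partial>lborel) = ennreal (integral {0..t} f)"
proof -
  have si: "set_integrable lebesgue {0..t} f"
    and nn: "\<And>u. 0 \<le> u \<Longrightarrow> 0 \<le> f u"
    using assms by (auto simp: nonneg_L1_loc_def)
  have "(\<integral>\<^sup>+u\<in>{0..t}. ennreal (f u) \<partial>lborel)
      = (\<integral>\<^sup>+u. ennreal (indicator {0..t} u *\<^sub>R f u) \<partial>lebesgue)"
    unfolding nn_integral_completion
    by (intro nn_integral_cong) (auto simp: indicator_def)
  also have "\<dots> = ennreal (LINT u:{0..t}|lebesgue. f u)"
    unfolding set_lebesgue_integral_def
    using si[unfolded set_integrable_def] nn
    by (intro nn_integral_eq_integral) (auto simp: indicator_def)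
  also have "\<dots> = ennreal (integral {0..t} f)"
    using set_lebesgue_integral_eq_integral(2)[OF si] by simp
  finally show ?thesis .
qed

lemma nonneg_L1_locI:
  assumes "f \<in> borel_measurable (lebesgue_on {0..})" "\<And>t. 0 \<le> t \<Longrightarrow> 0 \<le> f t"
    and "\<And>t. 0 \<le> t \<Longrightarrow> (\<integral>\<^sup>+u\<in>{0..t}. ennreal (f u) \<partial>lborel) < \<infinity>"
  shows "nonneg_L1_loc f"
  unfolding nonneg_L1_loc_def
proof (intro conjI allI impI)
  fix t :: real assume t: "0 \<le> t"
  \<comment> \<open>At negative arguments \<open>f\<close> is arbitrary, so measurability on the
    half-line is moved to the whole line by first extending by 0.\<close>
  have "(\<lambda>u. if u \<in> {0..} then f u else 0) \<in> borel_measurable lebesgue"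
    using assms(1) by (intro borel_measurable_if_I) auto
  then have "(\<lambda>u. indicator {0..t} u *\<^sub>R (if u \<in> {0..} then f u else 0)) \<in> borel_measurable lebesgue"
    by (intro borel_measurable_scaleR borel_measurable_indicator) auto
  also have "(\<lambda>u. indicator {0..t} u *\<^sub>R (if u \<in> {0..} then f u else 0)) =
      (\<lambda>u. indicator {0..t} u *\<^sub>R f u)"
    by (auto simp: indicator_def)
  finally have m: "(\<lambda>u. indicator {0..t} u *\<^sub>R f u) \<in> borel_measurable lebesgue" .
  have "(\<integral>\<^sup>+u. ennreal (indicator {0..t} u *\<^sub>R f u) \<partial>lebesgue)
      = (\<integral>\<^sup>+u\<in>{0..t}. ennreal (f u) \<partial>lborel)"
    unfolding nn_integral_completion
    by (intro nn_integral_cong) (auto simp: indicator_def)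
  then show "set_integrable lebesgue {0..t} f"
    unfolding set_integrable_def using m assms(2) assms(3)[OF t]
    by (intro integrableI_nonneg) (auto simp: indicator_def)
qed (use assms in auto)

section \<open>Borel representatives and primitives of convolutions\<close>

text \<open>
  Fubini's theorem for \<open>g (t - u) * h u\<close> needs Borel representatives: for merely Lebesgue
  measurable \<open>g\<close>, the map \<open>(t, u) \<mapsto> g (t - u)\<close> need not be measurable for the product of the
  completed measures.
\<close>

lemma nonneg_L1_loc_borel_representative:
  assumes "nonneg_L1_loc f"
  obtains k where "k \<in> borel_measurable borel" "\<And>u. 0 \<le> k u" "\<And>u. u < 0 \<Longrightarrow> k u = 0"
    "AE u in lborel. 0 \<le> u \<longrightarrow> f u = k u"
proof -
  have "(\<lambda>u. if u \<in> {0..} then f u else 0) \<in> borel_measurable lebesgue"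
    using assms by (intro borel_measurable_if_I) (auto simp: nonneg_L1_loc_def)
  then obtain k where k[measurable]: "k \<in> borel_measurable lborel"
    and eq: "AE u in lborel. (if u \<in> {0..} then f u else 0) = k u"
    using completion_ex_borel_measurable_real by blast
  show thesis
  \<comment> \<open>Cutting off at 0 and taking the positive part gives sign and support at every
    point. As \<open>f\<close> is nonnegative on the half-line, agreement almost everywhere is
    kept.\<close>
  proof (rule that[of "\<lambda>u. if 0 \<le> u then max 0 (k u) else 0"])
    show "(\<lambda>u. if 0 \<le> u then max 0 (k u) else 0) \<in> borel_measurable borel"
      using k by simp
    show "AE u in lborel. 0 \<le> u \<longrightarrow> f u = (if 0 \<le> u then max 0 (k u) else 0)"
      using eq assms by (auto simp: nonneg_L1_loc_def elim!: eventually_mono split: if_splits)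
  qed auto
qed

text \<open>Preimages under \<open>f\<close> and \<open>g\<close> differ by a null set, and Lebesgue
  measure is complete.\<close>

lemma borel_measurable_lebesgue_cong_AE:
  assumes f: "f \<in> borel_measurable lebesgue" and eq: "AE x in lebesgue. f x = g x"
  shows "g \<in> borel_measurable lebesgue"
proof (rule measurableI)
  fix A :: "'b set" assume A: "A \<in> sets borel"
  show "g -` A \<inter> space lebesgue \<in> sets lebesgue"
  proof (rule completion.in_sets_AE)
    show "f -` A \<inter> space lebesgue \<in> sets lebesgue"
      using f A by (rule measurable_sets)
    show "AE x in lebesgue. x \<in> f -` A \<inter> space lebesgue \<longleftrightarrow> x \<in> g -` A \<inter> space lebesgue"
      using eq by eventually_elim auto
  qed auto
qed auto

text \<open>For fixed \<open>t\<close> the reflection \<open>u \<mapsto> t - u\<close> preserves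
  null sets, so the integrands agree almost everywhere.\<close>

lemma convolve_cong_AE:
  assumes "AE u in lborel. 0 \<le> u \<longrightarrow> g u = g' u" "AE u in lborel. 0 \<le> u \<longrightarrow> h u = h' u"
    and [measurable]: "g' \<in> borel_measurable borel" "h' \<in> borel_measurable borel"
  shows "convolve g h t = convolve g' h' t"
proof -
  \<comment> \<open>A Borel null set covers the exceptional set, which need not be Borel, so that it
    can be pulled back along an affine map.\<close>
  obtain N where N: "N \<in> null_sets lborel" "{u. \<not> (0 \<le> u \<longrightarrow> g u = g' u)} \<subseteq> N"
    using assms(1) by (auto simp: eventually_ae_filter)
  have "AE u in lborel. u \<notin> N"
    using N by (intro AE_not_in)
  then have "AE u in lborel. t + (-1) * u \<notin> N"
    using N by (intro AE_borel_affine) auto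
  then have "AE u in lborel. 0 \<le> t - u \<longrightarrow> g (t - u) = g' (t - u)"
  proof eventually_elim
    case (elim u)
    then show ?case
      using N(2) by (auto dest: subsetD[of _ _ "t - u"])
  qed
  then have "AE u in lborel. indicator {0..t} u *\<^sub>R (g' (t - u) * h' u) = indicator {0..t} u *\<^sub>R (g (t - u) * h u)"
    using assms(2) by eventually_elim (auto simp: indicator_def)
  then have ae: "AE u in lebesgue. indicator {0..t} u *\<^sub>R (g' (t - u) * h' u) = indicator {0..t} u *\<^sub>R (g (t - u) * h u)"
    by (rule AE_completion)
  have "(\<lambda>u. indicator {0..t} u *\<^sub>R (g' (t - u) * h' u)) \<in> borel_measurable lborel"
    by measurable
  then have m: "(\<lambda>u. indicator {0..t} u *\<^sub>R (g' (t - u) * h' u)) \<in> borel_measurable lebesgue"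
    by (rule measurable_completion)
  \<comment> \<open>Equality of the Bochner integrals needs both integrands measurable; for the one
    with \<open>g\<close> and \<open>h\<close> this comes from completeness.\<close>
  show ?thesis
    unfolding convolve_def set_lebesgue_integral_def
    using borel_measurable_lebesgue_cong_AE[OF m ae] m ae
    by (intro integral_cong_AE) (auto elim!: eventually_mono)
qed

text \<open>The supports make the indicator of \<open>{0..t}\<close> redundant. If the integral
  diverges, both sides are 0: the Bochner integral by convention, the other because
  \<open>enn2real\<close> sends infinity to 0.\<close>

lemma convolve_eq_nn_integral:
  assumes [measurable]: "g \<in> borel_measurable borel" "h \<in> borel_measurable borel"
    and nn: "\<And>u. 0 \<le> g u" "\<And>u. 0 \<le> h u" and supp: "\<And>u. u < 0 \<Longrightarrow> g u = 0" "\<And>u. u < 0 \<Longrightarrow> h u = 0"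
  shows "convolve g h t = enn2real (\<integral>\<^sup>+u. ennreal (g (t - u)) * ennreal (h u) \<partial>lborel)"
proof -
  have "(\<lambda>u. indicator {0..t} u *\<^sub>R (g (t - u) * h u)) = (\<lambda>u. g (t - u) * h u)"
  proof
    fix u
    show "indicator {0..t} u *\<^sub>R (g (t - u) * h u) = g (t - u) * h u"
      using supp(1)[of "t - u"] supp(2)[of u] by (cases "u < 0"; cases "t < u") (auto simp: indicator_def)
  qed
  then have "convolve g h t = (LINT u|lebesgue. g (t - u) * h u)"
    by (simp add: convolve_def set_lebesgue_integral_def)
  also have "\<dots> = (LINT u|lborel. g (t - u) * h u)"
    by (intro integral_completion) measurable
  also have "\<dots> = enn2real (\<integral>\<^sup>+u. ennreal (g (t - u)) * ennreal (h u) \<partial>lborel)"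
    using nn by (subst integral_eq_nn_integral) (auto simp: ennreal_mult)
  finally show ?thesis .
qed

text \<open>Tonelli's theorem, followed by the translation \<open>t = u + v\<close> in the inner
  integral.\<close>

lemma nn_integral_convolution_swap:
  fixes g h :: "real \<Rightarrow> ennreal"
  assumes [measurable]: "g \<in> borel_measurable borel" "h \<in> borel_measurable borel"
  shows "(\<integral>\<^sup>+t. (\<integral>\<^sup>+u. g (t - u) * h u \<partial>lborel) * indicator {..T} t \<partial>lborel) =
    (\<integral>\<^sup>+u. (\<integral>\<^sup>+v. g v * h u * indicator {..T} (u + v) \<partial>lborel) \<partial>lborel)"
proof -
  have "(\<integral>\<^sup>+t. (\<integral>\<^sup>+u. g (t - u) * h u \<partial>lborel) * indicator {..T} t \<partial>lborel) =
      (\<integral>\<^sup>+t. (\<integral>\<^sup>+u. g (t - u) * h u * indicator {..T} t \<partial>lborel) \<partial>lborel)"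
    by (intro nn_integral_cong nn_integral_multc[symmetric]) measurable
  also have "\<dots> = (\<integral>\<^sup>+u. (\<integral>\<^sup>+t. g (t - u) * h u * indicator {..T} t \<partial>lborel) \<partial>lborel)"
    by (rule lborel_pair.Fubini') measurable
  also have "\<dots> = (\<integral>\<^sup>+u. (\<integral>\<^sup>+v. g v * h u * indicator {..T} (u + v) \<partial>lborel) \<partial>lborel)"
  proof (rule nn_integral_cong)
    fix u
    show "(\<integral>\<^sup>+t. g (t - u) * h u * indicator {..T} t \<partial>lborel) =
        (\<integral>\<^sup>+v. g v * h u * indicator {..T} (u + v) \<partial>lborel)"
      by (subst nn_integral_real_affine[where c = 1 and t = u]) (auto simp: one_ennreal_def[symmetric])
  qed
  finally show ?thesis .
qed

text \<open>In the quadrant, the triangle \<open>u + v \<le> T\<close> contains the rectangle with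
  sides \<open>s\<close> and \<open>t\<close> if \<open>T = s + t\<close>, and lies in the square
  with side \<open>T\<close>. The square bound also gives finiteness almost everywhere, hence local
  integrability.\<close>

lemma
  assumes "nonneg_L1_loc g" "nonneg_L1_loc h"
  shows nonneg_L1_loc_convolve: "nonneg_L1_loc (convolve g h)"
    and integral_convolve_ge: "0 \<le> s \<Longrightarrow> 0 \<le> t \<Longrightarrow>
      integral {0..s} g * integral {0..t} h \<le> integral {0..s + t} (convolve g h)"
    and integral_convolve_le: "0 \<le> t \<Longrightarrow>
      integral {0..t} (convolve g h) \<le> integral {0..t} g * integral {0..t} h"
proof -
  obtain g' where g'[measurable]: "g' \<in> borel_measurable borel" and g'_nn: "\<And>u. 0 \<le> g' u"
    and g'_supp: "\<And>u. u < 0 \<Longrightarrow> g' u = 0" and g_g': "AE u in lborel. 0 \<le> u \<longrightarrow> g u = g' u"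
    using nonneg_L1_loc_borel_representative[OF assms(1)] by blast
  obtain h' where h'[measurable]: "h' \<in> borel_measurable borel" and h'_nn: "\<And>u. 0 \<le> h' u"
    and h'_supp: "\<And>u. u < 0 \<Longrightarrow> h' u = 0" and h_h': "AE u in lborel. 0 \<le> u \<longrightarrow> h u = h' u"
    using nonneg_L1_loc_borel_representative[OF assms(2)] by blast
  \<comment> \<open>The convolution with values in [0, \<infinity>]. Unlike \<open>convolve\<close>
    it does not turn divergence into 0, so Tonelli's theorem applies to it.\<close>
  define k where "k t = (\<integral>\<^sup>+u. ennreal (g' (t - u)) * ennreal (h' u) \<partial>lborel)" for t
  have k[measurable]: "k \<in> borel_measurable borel"
    unfolding k_def[abs_def] by measurable
  have conv: "convolve g h = (\<lambda>t. enn2real (k t))"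
    unfolding k_def
    using convolve_cong_AE[OF g_g' h_h' g' h'] convolve_eq_nn_integral[OF g' h' g'_nn h'_nn g'_supp h'_supp]
    by (intro ext) simp
  have G: "(\<integral>\<^sup>+v. ennreal (g' v) * indicator {..t} v \<partial>lborel) = ennreal (integral {0..t} g)" if "0 \<le> t" for t
  proof -
    have "(\<integral>\<^sup>+v. ennreal (g' v) * indicator {..t} v \<partial>lborel) = (\<integral>\<^sup>+v\<in>{0..t}. ennreal (g v) \<partial>lborel)"
      using g_g' by (intro nn_integral_cong_AE) (auto simp: indicator_def g'_supp elim!: eventually_mono)
    then show ?thesis
      using nonneg_L1_loc_nn_integral[OF assms(1) that] by simp
  qed
  have H: "(\<integral>\<^sup>+v. ennreal (h' v) * indicator {..t} v \<partial>lborel) = ennreal (integral {0..t} h)" if "0 \<le> t" for t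
  proof -
    have "(\<integral>\<^sup>+v. ennreal (h' v) * indicator {..t} v \<partial>lborel) = (\<integral>\<^sup>+v\<in>{0..t}. ennreal (h v) \<partial>lborel)"
      using h_h' by (intro nn_integral_cong_AE) (auto simp: indicator_def h'_supp elim!: eventually_mono)
    then show ?thesis
      using nonneg_L1_loc_nn_integral[OF assms(2) that] by simp
  qed
  have GH: "(\<integral>\<^sup>+u. (\<integral>\<^sup>+v. (ennreal (g' v) * indicator {..s} v) * (ennreal (h' u) * indicator {..t} u) \<partial>lborel) \<partial>lborel)
      = ennreal (integral {0..s} g * integral {0..t} h)" if "0 \<le> s" "0 \<le> t" for s t
    using that nonneg_L1_loc_integral_nonneg[OF assms(1)] nonneg_L1_loc_integral_nonneg[OF assms(2)]
    by (simp add: nn_integral_multc nn_integral_cmult G H ennreal_mult)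
  have K: "(\<integral>\<^sup>+t. k t * indicator {..T} t \<partial>lborel) =
      (\<integral>\<^sup>+u. (\<integral>\<^sup>+v. ennreal (g' v) * ennreal (h' u) * indicator {..T} (u + v) \<partial>lborel) \<partial>lborel)" for T
    unfolding k_def by (intro nn_integral_convolution_swap) measurable
  have K_le: "(\<integral>\<^sup>+t. k t * indicator {..T} t \<partial>lborel) \<le> ennreal (integral {0..T} g * integral {0..T} h)"
    if "0 \<le> T" for T
    unfolding K GH[OF that that, symmetric]
  proof (intro nn_integral_mono)
    fix u v
    \<comment> \<open>Negative \<open>u\<close> or \<open>v\<close> contribute 0; otherwise
      \<open>u + v \<le> T\<close> forces \<open>u \<le> T\<close> and
      \<open>v \<le> T\<close>.\<close>
    show "ennreal (g' v) * ennreal (h' u) * indicator {..T} (u + v)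
        \<le> ennreal (g' v) * indicator {..T} v * (ennreal (h' u) * indicator {..T} u)"
      using g'_supp[of v] h'_supp[of u] by (cases "v < 0"; cases "u < 0") (auto simp: indicator_def)
  qed
  have K_ge: "ennreal (integral {0..s} g * integral {0..t} h) \<le> (\<integral>\<^sup>+r. k r * indicator {..s + t} r \<partial>lborel)"
    if "0 \<le> s" "0 \<le> t" for s t
    unfolding K GH[OF that, symmetric]
    by (intro nn_integral_mono) (auto simp: indicator_def)
  have k_finite: "AE t in lborel. t \<le> T \<longrightarrow> k t \<noteq> \<infinity>" if "0 \<le> T" for T
  proof -
    have "AE t in lborel. k t * indicator {..T} t \<noteq> \<infinity>"
      using K_le[OF that] by (intro nn_integral_noteq_infinite) (auto simp: top_unique)
    then show ?thesis
      by eventually_elim (auto simp: indicator_def)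
  qed
  have k_neg: "k t = 0" if "t < 0" for t
  proof -
    have "ennreal (g' (t - u)) * ennreal (h' u) = 0" for u
      using g'_supp[of "t - u"] h'_supp[of u] that by (cases "u < 0") auto
    then show ?thesis by (simp only: k_def nn_integral_const mult_zero_left)
  qed
  \<comment> \<open>Where \<open>k\<close> is infinite, \<open>convolve\<close> is 0; by
    \<open>k_finite\<close> this concerns only a null set.\<close>
  have C: "(\<integral>\<^sup>+t\<in>{0..T}. ennreal (convolve g h t) \<partial>lborel) = (\<integral>\<^sup>+t. k t * indicator {..T} t \<partial>lborel)"
    if "0 \<le> T" for T
    using k_finite[OF that]
    by (intro nn_integral_cong_AE, eventually_elim)
      (auto simp: conv indicator_def k_neg less_top)
  show nice: "nonneg_L1_loc (convolve g h)"
  proof (rule nonneg_L1_locI)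
    have "convolve g h \<in> borel_measurable lborel"
      unfolding conv by measurable
    then have "convolve g h \<in> borel_measurable lebesgue"
      by (rule measurable_completion)
    then show "convolve g h \<in> borel_measurable (lebesgue_on {0..})"
      by (rule measurable_restrict_space1)
    show "(\<integral>\<^sup>+u\<in>{0..t}. ennreal (convolve g h u) \<partial>lborel) < \<infinity>" if "0 \<le> t" for t
      unfolding C[OF that] using K_le[OF that] by (rule order.strict_trans1) simp
  qed (simp add: conv)
  have K_eq: "(\<integral>\<^sup>+t. k t * indicator {..T} t \<partial>lborel) = ennreal (integral {0..T} (convolve g h))"
    if "0 \<le> T" for T
    using C[OF that] nonneg_L1_loc_nn_integral[OF nice that] by simp
  show "integral {0..s} g * integral {0..t} h \<le> integral {0..s + t} (convolve g h)"
    if "0 \<le> s" "0 \<le> t"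
    using K_ge[OF that] K_eq[of "s + t"] that nonneg_L1_loc_integral_nonneg[OF nice]
    by (metis add_nonneg_nonneg ennreal_le_iff)
  show "integral {0..t} (convolve g h) \<le> integral {0..t} g * integral {0..t} h" if "0 \<le> t"
    using K_le[OF that] nonneg_L1_loc_integral_nonneg[OF assms(1)] nonneg_L1_loc_integral_nonneg[OF assms(2)]
    unfolding K_eq[OF that] by (metis ennreal_le_iff mult_nonneg_nonneg)
qed

section \<open>Iterated convolutions\<close>

lemma conv_prod_Suc_0 [simp]: "conv_prod f (Suc 0) = f 1"
  by (simp add: conv_prod_def)

lemma conv_prod_Suc: "n \<ge> 1 \<Longrightarrow> conv_prod f (Suc n) = convolve (conv_prod f n) (f (Suc n))"
  by (simp add: conv_prod_def)

text \<open>Induction on \<open>n\<close>. In the lower bound the new factor is integrated up to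
  \<open>t\<close> and the previous product up to \<open>n * t\<close>, so the endpoint grows by
  \<open>t\<close> per factor. Integrability is carried along because both one-step bounds require
  it.\<close>

lemma
  assumes "n \<ge> 1" "\<And>i. i \<in> {1..n} \<Longrightarrow> nonneg_L1_loc (f i)"
  shows nonneg_L1_loc_conv_prod: "nonneg_L1_loc (conv_prod f n)"
    and integral_conv_prod_ge: "0 \<le> t \<Longrightarrow>
      (\<Prod>i\<in>{1..n}. integral {0..t} (f i)) \<le> integral {0..real n * t} (conv_prod f n)"
    and integral_conv_prod_le: "0 \<le> t \<Longrightarrow>
      integral {0..t} (conv_prod f n) \<le> (\<Prod>i\<in>{1..n}. integral {0..t} (f i))"
proof -
  have "nonneg_L1_loc (conv_prod f n) \<and> (\<forall>t\<ge>0.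
      (\<Prod>i\<in>{1..n}. integral {0..t} (f i)) \<le> integral {0..real n * t} (conv_prod f n) \<and>
      integral {0..t} (conv_prod f n) \<le> (\<Prod>i\<in>{1..n}. integral {0..t} (f i)))"
    using assms
  proof (induction n rule: nat_induct_at_least)
    case base
    then show ?case by simp
  next
    case (Suc n)
    then have P: "nonneg_L1_loc (conv_prod f n)" and F: "nonneg_L1_loc (f (Suc n))"
      and ge: "\<And>t. 0 \<le> t \<Longrightarrow> (\<Prod>i\<in>{1..n}. integral {0..t} (f i)) \<le> integral {0..real n * t} (conv_prod f n)"
      and le: "\<And>t. 0 \<le> t \<Longrightarrow> integral {0..t} (conv_prod f n) \<le> (\<Prod>i\<in>{1..n}. integral {0..t} (f i))"
      by auto
    show ?case
      unfolding conv_prod_Suc[OF Suc.hyps] prod.nat_ivl_Suc'[OF le_SucI[OF Suc.hyps]]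
    proof (intro conjI allI impI)
      show "nonneg_L1_loc (convolve (conv_prod f n) (f (Suc n)))"
        using P F by (rule nonneg_L1_loc_convolve)
    next
      fix t :: real assume t: "0 \<le> t"
      have "integral {0..t} (f (Suc n)) * (\<Prod>i\<in>{1..n}. integral {0..t} (f i))
          \<le> integral {0..real n * t} (conv_prod f n) * integral {0..t} (f (Suc n))"
        using ge[OF t] nonneg_L1_loc_integral_nonneg[OF F] by (simp add: mult.commute mult_left_mono)
      also have "\<dots> \<le> integral {0..real n * t + t} (convolve (conv_prod f n) (f (Suc n)))"
        using t by (intro integral_convolve_ge P F) auto
      finally show "integral {0..t} (f (Suc n)) * (\<Prod>i\<in>{1..n}. integral {0..t} (f i))
          \<le> integral {0..real (Suc n) * t} (convolve (conv_prod f n) (f (Suc n)))"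
        by (simp add: algebra_simps)
      have "integral {0..t} (convolve (conv_prod f n) (f (Suc n)))
          \<le> integral {0..t} (conv_prod f n) * integral {0..t} (f (Suc n))"
        using t by (intro integral_convolve_le P F)
      also have "\<dots> \<le> integral {0..t} (f (Suc n)) * (\<Prod>i\<in>{1..n}. integral {0..t} (f i))"
        by (subst mult.commute) (rule mult_left_mono[OF le[OF t] nonneg_L1_loc_integral_nonneg[OF F]])
      finally show "integral {0..t} (convolve (conv_prod f n) (f (Suc n)))
          \<le> integral {0..t} (f (Suc n)) * (\<Prod>i\<in>{1..n}. integral {0..t} (f i))" .
    qed
  qed
  then show "nonneg_L1_loc (conv_prod f n)"
    "0 \<le> t \<Longrightarrow> (\<Prod>i\<in>{1..n}. integral {0..t} (f i)) \<le> integral {0..real n * t} (conv_prod f n)"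
    "0 \<le> t \<Longrightarrow> integral {0..t} (conv_prod f n) \<le> (\<Prod>i\<in>{1..n}. integral {0..t} (f i))"
    by auto
qed

section \<open>Primitives of regularly varying functions\<close>

lemma nonneg_L1_loc_integral_mono:
  assumes "nonneg_L1_loc f" "s \<le> t"
  shows "integral {0..s} f \<le> integral {0..t} f"
proof (cases "0 \<le> s")
  case True
  then show ?thesis
    using assms nonneg_L1_loc_integrable_on[OF assms(1)]
    by (intro integral_subset_le) (auto simp: nonneg_L1_loc_def)
next
  case False
  then show ?thesis using nonneg_L1_loc_integral_nonneg[OF assms(1)] by simp
qed

text \<open>At \<open>l = 1\<close> the quotient is \<open>f t / f t\<close>, which is 0 wherever
  \<open>f t = 0\<close> and so is not close to 1 there.\<close>

lemma RV0_eventually_pos: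
  assumes "f \<in> RV0 \<alpha>"
  shows "eventually (\<lambda>t. 0 < f t) (at_right 0)"
proof -
  have "((\<lambda>t. f (1 * t) / f t) \<longlongrightarrow> 1 powr \<alpha>) (at_right 0)"
    using assms unfolding RV0_def by (blast intro: zero_less_one)
  then have "eventually (\<lambda>t. 0 < f (1 * t) / f t) (at_right 0)"
    by (rule order_tendstoD) simp
  moreover have "eventually (\<lambda>t::real. 0 < t) (at_right 0)"
    by (rule eventually_at_right_less)
  ultimately show ?thesis
  proof eventually_elim
    case (elim t)
    then have "f t \<noteq> 0" "0 \<le> f t"
      using assms by (auto simp: RV0_def)
    then show ?case by simp
  qed
qed

text \<open>\<open>f\<close> is positive on an interval to the right of 0, which a zero integral
  would make null. This keeps quotients of primitives meaningful.\<close>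

lemma integral_pos_RV0:
  assumes "f \<in> RV0 \<alpha>" "nonneg_L1_loc f" "0 < t"
  shows "0 < integral {0..t} f"
proof -
  obtain c where c: "0 < c" "\<And>u. 0 < u \<Longrightarrow> u < c \<Longrightarrow> 0 < f u"
    using RV0_eventually_pos[OF assms(1)] by (auto simp: eventually_at_right_field)
  have si: "integrable lebesgue (\<lambda>u. indicator {0..t} u *\<^sub>R f u)"
    using assms(2,3) unfolding nonneg_L1_loc_def set_integrable_def by auto
  have nn: "0 \<le> indicator {0..t} u *\<^sub>R f u" for u
    using assms(2) by (auto simp: nonneg_L1_loc_def indicator_def)
  have I: "integral {0..t} f = (LINT u|lebesgue. indicator {0..t} u *\<^sub>R f u)"
    using set_lebesgue_integral_eq_integral(2)[of "{0..t}" f] assms(2,3)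
    unfolding nonneg_L1_loc_def set_lebesgue_integral_def by auto
  have "integral {0..t} f \<noteq> 0"
  proof
    assume "integral {0..t} f = 0"
    then have "AE u in lebesgue. indicator {0..t} u *\<^sub>R f u = 0"
      unfolding I using nn by (subst (asm) integral_nonneg_eq_0_iff_AE[OF si]) auto
    then have "AE u in lborel. indicator {0..t} u *\<^sub>R f u = 0"
      by (simp only: AE_completion_iff)
    then have "AE u in lborel. u \<notin> {0<..<min c t}"
    proof eventually_elim
      case (elim u)
      then show ?case
        using c(2)[of u] by (auto simp: indicator_def split: if_splits)
    qed
    then have "emeasure lborel {0<..<min c t} = 0"
      by (subst (asm) AE_iff_measurable[of "{0<..<min c t}"]) auto
    then show False
      using c(1) assms(3) by simp
  qed
  then show ?thesis
    using nonneg_L1_loc_integral_nonneg[OF assms(2), of t] by simp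
qed

text \<open>By the substitution \<open>u = v / 2\<close>, twice the primitive at
  \<open>t / 2\<close> is the integral of \<open>f (v / 2)\<close> over \<open>{0..t}\<close>. Near
  0 this integrand is within \<open>e * f v\<close> of \<open>(1/2) powr \<alpha> * f v\<close>;
  dividing by 2 raises the exponent to \<open>\<alpha> + 1\<close>.\<close>

lemma integral_halving_RV0:
  assumes "f \<in> RV0 \<alpha>" "nonneg_L1_loc f"
  shows "((\<lambda>t. integral {0..t / 2} f / integral {0..t} f) \<longlongrightarrow> (1/2) powr (\<alpha> + 1)) (at_right 0)"
proof (rule tendstoI)
  fix e :: real assume e: "0 < e"
  define c :: real where "c = (1/2) powr \<alpha>"
  have "((\<lambda>t. f ((1/2) * t) / f t) \<longlongrightarrow> c) (at_right 0)"
    using assms(1) unfolding RV0_def c_def by (simp del: times_divide_eq_left)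
  then have "eventually (\<lambda>t. dist (f ((1/2) * t) / f t) c < e) (at_right 0)"
    using e by (rule tendstoD)
  \<comment> \<open>Multiplying by \<open>f t > 0\<close> turns the estimate of the quotient into
    one that can be integrated.\<close>
  with RV0_eventually_pos[OF assms(1)]
  have "eventually (\<lambda>t. \<bar>f ((1/2) * t) - c * f t\<bar> \<le> e * f t) (at_right 0)"
  proof eventually_elim
    case (elim t)
    then have "\<bar>f ((1/2) * t) / f t - c\<bar> * f t \<le> e * f t"
      by (intro mult_right_mono) (auto simp: dist_real_def)
    also have "\<bar>f ((1/2) * t) / f t - c\<bar> * f t = \<bar>(f ((1/2) * t) / f t - c) * f t\<bar>"
      using elim by (simp add: abs_mult)
    also have "(f ((1/2) * t) / f t - c) * f t = f ((1/2) * t) - c * f t"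
      using elim by (simp add: field_simps)
    finally show ?case .
  qed
  then obtain b where b: "0 < b" "\<And>t. 0 < t \<Longrightarrow> t < b \<Longrightarrow> \<bar>f ((1/2) * t) - c * f t\<bar> \<le> e * f t"
    by (auto simp: eventually_at_right_field)
  have "dist (integral {0..t / 2} f / integral {0..t} f) ((1/2) powr (\<alpha> + 1)) < e"
    if t: "0 < t" "t < b" for t
  proof -
    define F where "F = integral {0..t} f"
    have F: "0 < F"
      unfolding F_def using assms t(1) by (rule integral_pos_RV0)
    have f_int: "(f has_integral F) {0..t}"
      unfolding F_def using nonneg_L1_loc_integrable_on[OF assms(2), of t] t by auto
    have "(f has_integral integral {0..t / 2} f) {0..t / 2}"
      using nonneg_L1_loc_integrable_on[OF assms(2), of "t / 2"] t by auto
    moreover have "(\<lambda>x. x / (1/2)) ` {0..t / 2} = {0..t}"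
      using t by (subst image_divide_atLeastAtMost) auto
    ultimately
    have g_int: "((\<lambda>v. f ((1/2) * v)) has_integral 2 * integral {0..t / 2} f) {0..t}"
      using has_integral_stretch_real[of f "integral {0..t / 2} f" 0 "t / 2" "1/2"] by simp
    have "((\<lambda>v. f ((1/2) * v) - c * f v) has_integral 2 * integral {0..t / 2} f - c * F) {0..t}"
      by (intro has_integral_diff g_int has_integral_mult_right f_int)
    \<comment> \<open>The right-hand limit gives no bound at \<open>v = 0\<close>; resetting one
      value does not affect the integral.\<close>
    then have "((\<lambda>v. if v = 0 then 0 else f ((1/2) * v) - c * f v)
        has_integral 2 * integral {0..t / 2} f - c * F) {0..t}"
      by (rule has_integral_spike_finite[of "{0}", rotated 2]) auto
    moreover have "((\<lambda>v. e * f v) has_integral e * F) {0..t}"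
      by (intro has_integral_mult_right f_int)
    ultimately have "norm (2 * integral {0..t / 2} f - c * F) \<le> (e * F) \<bullet> 1"
    proof (rule has_integral_norm_bound_integral_component)
      fix v assume "v \<in> {0..t}"
      then show "norm (if v = 0 then 0 else f ((1/2) * v) - c * f v) \<le> (e * f v) \<bullet> 1"
        using b(2)[of v] t e assms(2) by (auto simp: nonneg_L1_loc_def)
    qed
    then have "\<bar>(2 * integral {0..t / 2} f - c * F) / F\<bar> \<le> e"
      using F by (simp add: abs_divide field_simps)
    \<comment> \<open>Since \<open>2 * (1/2) powr (\<alpha> + 1) = (1/2) powr \<alpha>\<close>, the
      error is \<open>2 * r\<close>, and the bound by \<open>e\<close> becomes strict for
      \<open>r\<close>.\<close>
    moreover define r where "r = integral {0..t / 2} f / F - (1/2) powr (\<alpha> + 1)"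
    moreover have "(2 * integral {0..t / 2} f - c * F) / F = 2 * r"
      using F by (simp add: r_def c_def powr_add field_simps)
    ultimately have "\<bar>r\<bar> < e"
      using e by simp
    then show ?thesis
      by (simp add: r_def F_def dist_real_def)
  qed
  then show "eventually (\<lambda>t. dist (integral {0..t / 2} f / integral {0..t} f) ((1/2) powr (\<alpha> + 1)) < e) (at_right 0)"
    using b(1) by (auto simp: eventually_at_right_field)
qed

section \<open>Sequences with convergent successive ratios\<close>

lemma ratio_limit_tendsto_0:
  fixes r :: "nat \<Rightarrow> real"
  assumes "\<And>n. 0 < r n" "(\<lambda>n. r (Suc n) / r n) \<longlonglongrightarrow> q" "q < 1"
  shows "r \<longlonglongrightarrow> 0"
proof -
  obtain p where p: "q < p" "p < 1"
    using dense[OF assms(3)] by blast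
  have "eventually (\<lambda>n. r (Suc n) / r n < p) sequentially"
    using assms(2) p(1) by (rule order_tendstoD)
  then obtain N where "\<And>n. N \<le> n \<Longrightarrow> r (Suc n) / r n < p"
    by (auto simp: eventually_sequentially)
  then have "norm (r (Suc n)) \<le> p * norm (r n)" if "N \<le> n" for n
    using assms(1)[of n] assms(1)[of "Suc n"] that by (fastforce simp: pos_divide_less_eq intro: less_imp_le)
  then have "summable r"
    using p(2) by (intro summable_ratio_test)
  then show ?thesis
    by (rule summable_LIMSEQ_zero)
qed

text \<open>The quotient telescopes into \<open>k\<close> successive ratios, each with limit
  \<open>c\<close>.\<close>

lemma ratio_limit_shift:
  fixes x :: "nat \<Rightarrow> real"
  assumes "\<And>n. 0 < x n" "(\<lambda>n. x (Suc n) / x n) \<longlonglongrightarrow> c"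
  shows "(\<lambda>n. x (n + k) / x n) \<longlonglongrightarrow> c ^ k"
proof (induction k)
  case 0
  have "x n \<noteq> 0" for n using assms(1)[of n] by simp
  then show ?case by simp
next
  case (Suc k)
  have "(\<lambda>n. x (Suc (n + k)) / x (n + k) * (x (n + k) / x n)) \<longlonglongrightarrow> c * c ^ k"
    by (intro tendsto_mult Suc.IH LIMSEQ_ignore_initial_segment[OF assms(2)])
  moreover have "x (n + k) \<noteq> 0" for n using assms(1)[of "n + k"] by simp
  ultimately show ?case by simp
qed

text \<open>Each \<open>y s n / x n\<close> has ratio limit \<open>b s / c < 1\<close> and tends to
  0, while \<open>x (n + k) / x n\<close> tends to \<open>c ^ k > 0\<close>. A fixed index shift,
  the price of rescaling the argument, is thus harmless.\<close>

lemma ratio_limit_domination_contradiction: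
  fixes x :: "nat \<Rightarrow> real" and y :: "'a \<Rightarrow> nat \<Rightarrow> real"
  assumes x: "\<And>n. 0 < x n" "(\<lambda>n. x (Suc n) / x n) \<longlonglongrightarrow> c" "0 < c"
    and y: "\<And>s n. s \<in> S \<Longrightarrow> 0 < y s n" "\<And>s. s \<in> S \<Longrightarrow> (\<lambda>n. y s (Suc n) / y s n) \<longlonglongrightarrow> b s"
      "\<And>s. s \<in> S \<Longrightarrow> b s < c"
    and le: "eventually (\<lambda>n. x (n + k) \<le> (\<Sum>s\<in>S. y s n)) sequentially"
  shows False
proof -
  have "(\<lambda>n. y s n / x n) \<longlonglongrightarrow> 0" if s: "s \<in> S" for s
  proof (rule ratio_limit_tendsto_0)
    have "(\<lambda>n. (y s (Suc n) / y s n) / (x (Suc n) / x n)) \<longlonglongrightarrow> b s / c"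
      using x y(2)[OF s] by (intro tendsto_divide) auto
    then show "(\<lambda>n. y s (Suc n) / x (Suc n) / (y s n / x n)) \<longlonglongrightarrow> b s / c"
      by (simp add: mult.commute)
    show "b s / c < 1"
      using y(3)[OF s] x(3) by simp
  qed (use x(1) y(1)[OF s] in simp)
  then have "(\<lambda>n. \<Sum>s\<in>S. y s n / x n) \<longlonglongrightarrow> 0"
    by (rule tendsto_null_sum)
  moreover have "(\<lambda>n. x (n + k) / x n) \<longlonglongrightarrow> c ^ k"
    using x(1,2) by (rule ratio_limit_shift)
  moreover have "eventually (\<lambda>n. x (n + k) / x n \<le> (\<Sum>s\<in>S. y s n / x n)) sequentially"
    using le
  proof eventually_elim
    case (elim n)
    then show ?case
      using x(1)[of n] by (simp add: sum_divide_distrib[symmetric] divide_right_mono)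
  qed
  ultimately have "c ^ k \<le> 0"
    by (intro tendsto_le[OF sequentially_bot])
  then show False
    using zero_less_power[OF x(3), of k] by linarith
qed

section \<open>Comparison of primitives and dyadic ratios\<close>

lemma integral_le_sum_AE:
  assumes "nonneg_L1_loc f" "\<And>s. s \<in> S \<Longrightarrow> nonneg_L1_loc (g s)" "0 \<le> T" "finite S"
    and "AE t in lborel. t \<in> {0..T} \<longrightarrow> f t \<le> (\<Sum>s\<in>S. g s t)"
  shows "integral {0..T} f \<le> (\<Sum>s\<in>S. integral {0..T} (g s))"
proof -
  have nice: "nonneg_L1_loc (\<lambda>t. \<Sum>s\<in>S. g s t)"
    using assms(2,4) unfolding nonneg_L1_loc_def
    by (auto intro!: borel_measurable_sum sum_nonneg absolutely_integrable_sum)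
  have "ennreal (integral {0..T} f) \<le> ennreal (integral {0..T} (\<lambda>t. \<Sum>s\<in>S. g s t))"
    unfolding nonneg_L1_loc_nn_integral[OF assms(1,3), symmetric]
      nonneg_L1_loc_nn_integral[OF nice assms(3), symmetric]
    using assms(5) by (intro nn_integral_mono_AE) (auto simp: indicator_def ennreal_leI elim!: eventually_mono)
  then have "integral {0..T} f \<le> integral {0..T} (\<lambda>t. \<Sum>s\<in>S. g s t)"
    using nonneg_L1_loc_integral_nonneg[OF nice] by simp
  also have "\<dots> = (\<Sum>s\<in>S. integral {0..T} (g s))"
    using assms by (intro integral_sum nonneg_L1_loc_integrable_on) auto
  finally show ?thesis .
qed

text \<open>Passing from \<open>n\<close> to \<open>n + 1\<close> halves the endpoint, so the
  quotient is a product of halving quotients, and the exponents \<open>\<alpha> i + 1\<close> add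
  up. The term \<open>d\<close> is common to all permutations, which leaves the sums of indices to
  compare.\<close>

lemma prod_integral_ratio_limit:
  fixes f :: "nat \<Rightarrow> real \<Rightarrow> real"
  assumes "\<And>i. i \<in> {1..d} \<Longrightarrow> nonneg_L1_loc (f i)" "\<And>i. i \<in> {1..d} \<Longrightarrow> f i \<in> RV0 (\<alpha> i)"
  defines "p \<equiv> \<lambda>n. \<Prod>i\<in>{1..d}. integral {0..(1/2) ^ n} (f i)"
  shows "(\<lambda>n. p (Suc n) / p n) \<longlonglongrightarrow> (1/2) powr ((\<Sum>i\<in>{1..d}. \<alpha> i) + real d)"
    and "0 < p n"
proof -
  show "0 < p n"
    unfolding p_def by (intro prod_pos integral_pos_RV0[OF assms(2,1)]) auto
  have "filterlim (\<lambda>n. (1/2::real) ^ n) (at_right 0) sequentially"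
    unfolding filterlim_at by (auto intro: LIMSEQ_realpow_zero)
  then have "(\<lambda>n. integral {0..(1/2) ^ n / 2} (f i) / integral {0..(1/2) ^ n} (f i))
      \<longlonglongrightarrow> (1/2) powr (\<alpha> i + 1)" if "i \<in> {1..d}" for i
    using integral_halving_RV0[OF assms(2,1)[OF that]] by (rule filterlim_compose[rotated])
  then have "(\<lambda>n. \<Prod>i\<in>{1..d}. integral {0..(1/2) ^ n / 2} (f i) / integral {0..(1/2) ^ n} (f i))
      \<longlonglongrightarrow> (\<Prod>i\<in>{1..d}. (1/2) powr (\<alpha> i + 1))"
    by (rule tendsto_prod)
  also have "(\<Prod>i\<in>{1..d}. (1/2) powr (\<alpha> i + 1)) = ((1/2) powr ((\<Sum>i\<in>{1..d}. \<alpha> i) + real d) :: real)"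
    by (subst powr_sum[symmetric]) (auto simp: sum.distrib)
  finally show "(\<lambda>n. p (Suc n) / p n) \<longlonglongrightarrow> (1/2) powr ((\<Sum>i\<in>{1..d}. \<alpha> i) + real d)"
    by (simp add: p_def prod_dividef)
qed

section \<open>Permutations of given sign and minimal exponents\<close>

lemma exists_permutation_sign:
  assumes "(2::nat) \<le> d" "s = 1 \<or> s = -1"
  shows "\<exists>\<sigma>. \<sigma> permutes {1..d} \<and> sign \<sigma> = s"
  using assms(2)
proof
  assume "s = 1"
  then show ?thesis by (intro exI[of _ id]) auto
next
  assume "s = -1"
  then show ?thesis
    using assms(1) by (intro exI[of _ "Transposition.transpose 1 2"]) (auto simp: permutes_swap_id sign_swap_id)
qed

text \<open>\<open>Min\<close> is meaningful for finite nonempty sets: there are finitely many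
  permutations, and some of either sign.\<close>

lemma
  assumes "2 \<le> d" "s = 1 \<or> s = -1"
  shows alpha_min_attained: "\<exists>\<sigma>. \<sigma> permutes {1..d} \<and> sign \<sigma> = s \<and> alpha_min d \<alpha> s = (\<Sum>i\<in>{1..d}. \<alpha> i (\<sigma> i))"
    and alpha_min_le: "\<sigma> permutes {1..d} \<Longrightarrow> sign \<sigma> = s \<Longrightarrow> alpha_min d \<alpha> s \<le> (\<Sum>i\<in>{1..d}. \<alpha> i (\<sigma> i))"
proof -
  let ?A = "{\<Sum>i\<in>{1..d}. \<alpha> i (\<sigma> i) | \<sigma>. \<sigma> permutes {1..d} \<and> sign \<sigma> = s}"
  have "?A \<subseteq> (\<lambda>\<sigma>. \<Sum>i\<in>{1..d}. \<alpha> i (\<sigma> i)) ` {\<sigma>. \<sigma> permutes {1..d}}"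
    by auto
  then have fin: "finite ?A"
    by (rule finite_subset) (intro finite_imageI finite_permutations finite_atLeastAtMost)
  have "?A \<noteq> {}"
    using exists_permutation_sign[OF assms] by blast
  then have "Min ?A \<in> ?A"
    using fin by (intro Min_in)
  then show "\<exists>\<sigma>. \<sigma> permutes {1..d} \<and> sign \<sigma> = s \<and> alpha_min d \<alpha> s = (\<Sum>i\<in>{1..d}. \<alpha> i (\<sigma> i))"
    unfolding alpha_min_def by auto
  show "alpha_min d \<alpha> s \<le> (\<Sum>i\<in>{1..d}. \<alpha> i (\<sigma> i))" if "\<sigma> permutes {1..d}" "sign \<sigma> = s"
    unfolding alpha_min_def using fin that by (intro Min_le) auto
qed

section \<open>Vanishing of the determinant near zero\<close>

lemma not_in_ess_supp_AE_zero:
  assumes "0 \<notin> ess_supp f"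
  obtains e where "0 < e" "AE t in lborel. t \<in> {0..<e} \<longrightarrow> f t = 0"
proof -
  have "open (- ess_supp f)"
    using ess_supp_smallest(1) by (simp add: open_Compl)
  then obtain e where e: "0 < e" "ball 0 e \<subseteq> - ess_supp f"
    using assms by (meson ComplI openE)
  have "AE t in lborel. t \<notin> ess_supp f \<longrightarrow> zero_extension f t = 0"
    using ess_supp_smallest(2)[of f] by (simp only: AE_completion_iff)
  then have "AE t in lborel. t \<in> {0..<e} \<longrightarrow> f t = 0"
  proof eventually_elim
    case (elim t)
    then show ?case
      using subsetD[OF e(2), of t] by (auto simp: zero_extension_def)
  qed
  with e(1) show thesis by (rule that)
qed

text \<open>Multiplying the determinant by \<open>s\<close> gives weight 1 to the terms of sign
  \<open>s\<close> and -1 to the others, so the two partial sums are equal. One nonnegative term is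
  at most the sum it belongs to.\<close>

lemma conv_det_zero_imp_le:
  assumes "conv_det d \<Phi> t = 0" "s = 1 \<or> s = -1" "\<sigma> permutes {1..d}" "sign \<sigma> = s"
    and "\<And>\<tau>. \<tau> permutes {1..d} \<Longrightarrow> 0 \<le> conv_prod (\<lambda>i. \<Phi> i (\<tau> i)) d t"
  shows "conv_prod (\<lambda>i. \<Phi> i (\<sigma> i)) d t
    \<le> (\<Sum>\<tau> | \<tau> permutes {1..d} \<and> sign \<tau> = -s. conv_prod (\<lambda>i. \<Phi> i (\<tau> i)) d t)"
proof -
  let ?P = "\<lambda>\<tau>. conv_prod (\<lambda>i. \<Phi> i (\<tau> i)) d t"
  let ?S = "\<lambda>s. {\<tau>. \<tau> permutes {1..d} \<and> sign \<tau> = s}"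
  have fin: "finite (?S r)" for r
    by (rule finite_subset[OF _ finite_permutations[of "{1..d}"]]) auto
  have split: "{\<tau>. \<tau> permutes {1..d}} = ?S s \<union> ?S (-s)"
    using assms(2) by (auto simp: sign_def)
  have "0 = of_int s * conv_det d \<Phi> t"
    using assms(1) by simp
  also have "\<dots> = (\<Sum>\<tau>\<in>?S s \<union> ?S (-s). of_int s * (of_int (sign \<tau>) * ?P \<tau>))"
    unfolding conv_det_def split sum_distrib_left ..
  also have "\<dots> = (\<Sum>\<tau>\<in>?S s. of_int s * (of_int (sign \<tau>) * ?P \<tau>)) + (\<Sum>\<tau>\<in>?S (-s). of_int s * (of_int (sign \<tau>) * ?P \<tau>))"
    using fin assms(2) by (intro sum.union_disjoint) auto
  also have "(\<Sum>\<tau>\<in>?S s. of_int s * (of_int (sign \<tau>) * ?P \<tau>)) = (\<Sum>\<tau>\<in>?S s. ?P \<tau>)"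
    using assms(2) by (intro sum.cong) auto
  also have "(\<Sum>\<tau>\<in>?S (-s). of_int s * (of_int (sign \<tau>) * ?P \<tau>)) = - (\<Sum>\<tau>\<in>?S (-s). ?P \<tau>)"
    unfolding sum_negf[symmetric] using assms(2) by (intro sum.cong) auto
  finally have "(\<Sum>\<tau>\<in>?S s. ?P \<tau>) = (\<Sum>\<tau>\<in>?S (-s). ?P \<tau>)"
    by simp
  moreover have "?P \<sigma> \<le> (\<Sum>\<tau>\<in>?S s. ?P \<tau>)"
    using assms(3-5) fin by (intro member_le_sum) auto
  ultimately show ?thesis by simp
qed

theorem proposition3p6:
  fixes d :: nat
    and \<Phi> :: "nat \<Rightarrow> nat \<Rightarrow> real \<Rightarrow> real"
    and \<alpha> :: "nat \<Rightarrow> nat \<Rightarrow> real"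
  assumes "d \<ge> 2"
    and "\<Phi> \<in> L1_loc d"
    and "\<And>i j. i \<in> {1..d} \<Longrightarrow> j \<in> {1..d} \<Longrightarrow> \<alpha> i j > -1 \<and> \<Phi> i j \<in> RV0 (\<alpha> i j)"
    and "alpha_min d \<alpha> 1 \<noteq> alpha_min d \<alpha> (-1)"
  shows "0 \<in> ess_supp (conv_det d \<Phi>)"
proof (rule ccontr)
  assume "0 \<notin> ess_supp (conv_det d \<Phi>)"
  then obtain e where e: "0 < e" "AE t in lborel. t \<in> {0..<e} \<longrightarrow> conv_det d \<Phi> t = 0"
    by (rule not_in_ess_supp_AE_zero)
  \<comment> \<open>\<open>s\<close> is the sign with the smaller minimum, which treats both
    orderings at once.\<close>
  obtain s :: int where s: "s = 1 \<or> s = -1" and less: "alpha_min d \<alpha> s < alpha_min d \<alpha> (-s)"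
  proof (cases "alpha_min d \<alpha> 1 < alpha_min d \<alpha> (-1)")
    case True
    then show ?thesis using that[of 1] by simp
  next
    case False
    then show ?thesis using that[of "-1"] assms(4) by simp
  qed
  obtain \<sigma> where \<sigma>: "\<sigma> permutes {1..d}" "sign \<sigma> = s" "alpha_min d \<alpha> s = (\<Sum>i\<in>{1..d}. \<alpha> i (\<sigma> i))"
    using alpha_min_attained[OF assms(1) s] by blast
  define S where "S = {\<tau>. \<tau> permutes {1..d} \<and> sign \<tau> = -s}"
  have fin: "finite S"
    unfolding S_def by (rule finite_subset[OF _ finite_permutations[of "{1..d}"]]) auto
  have exponent_less: "(\<Sum>i\<in>{1..d}. \<alpha> i (\<sigma> i)) < (\<Sum>i\<in>{1..d}. \<alpha> i (\<tau> i))" if "\<tau> \<in> S" for \<tau>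
    using less alpha_min_le[of d "-s" \<tau> \<alpha>] assms(1) s that \<sigma>(3) by (auto simp: S_def)
  have nice: "nonneg_L1_loc (\<Phi> i (\<tau> i))" and RV: "\<Phi> i (\<tau> i) \<in> RV0 (\<alpha> i (\<tau> i))"
    if "\<tau> permutes {1..d}" "i \<in> {1..d}" for \<tau> i
  proof -
    have j: "\<tau> i \<in> {1..d}"
      using that by (simp only: permutes_in_image)
    show "\<Phi> i (\<tau> i) \<in> RV0 (\<alpha> i (\<tau> i))"
      using assms(3)[OF that(2) j] by simp
    then show "nonneg_L1_loc (\<Phi> i (\<tau> i))"
      using assms(2) that(2) j unfolding L1_loc_def RV0_def nonneg_L1_loc_def by blast
  qed
  define P where "P \<tau> = conv_prod (\<lambda>i. \<Phi> i (\<tau> i)) d" for \<tau>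
  \<comment> \<open>These products bound the primitives of \<open>P\<close> from both sides, up to
    rescaling, and have explicit ratio limits.\<close>
  define p where "p \<tau> n = (\<Prod>i\<in>{1..d}. integral {0..(1/2) ^ n} (\<Phi> i (\<tau> i)))" for \<tau> n
  have P_nice: "nonneg_L1_loc (P \<tau>)" if "\<tau> permutes {1..d}" for \<tau>
    unfolding P_def using assms(1) nice[OF that] by (intro nonneg_L1_loc_conv_prod) auto
  have p_pos: "0 < p \<tau> n"
    and p_ratio: "(\<lambda>n. p \<tau> (Suc n) / p \<tau> n) \<longlonglongrightarrow> (1/2) powr ((\<Sum>i\<in>{1..d}. \<alpha> i (\<tau> i)) + real d)"
    if "\<tau> permutes {1..d}" for \<tau> n
    unfolding p_def
    using prod_integral_ratio_limit[of d "\<lambda>i. \<Phi> i (\<tau> i)" "\<lambda>i. \<alpha> i (\<tau> i)"] nice[OF that] RV[OF that]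
    by blast+
  \<comment> \<open>The shift by \<open>d\<close> absorbs the factor \<open>d\<close> in the
    endpoint of the lower bound, because \<open>d \<le> 2 ^ d\<close>.\<close>
  have le: "p \<sigma> (n + d) \<le> (\<Sum>\<tau>\<in>S. p \<tau> n)" if n: "(1/2) ^ n < e" for n
  proof -
    have "p \<sigma> (n + d) \<le> integral {0..real d * (1/2) ^ (n + d)} (P \<sigma>)"
      unfolding p_def P_def using assms(1) nice[OF \<sigma>(1)] by (intro integral_conv_prod_ge) auto
    also have "\<dots> \<le> integral {0..(1/2) ^ n} (P \<sigma>)"
    proof (rule nonneg_L1_loc_integral_mono[OF P_nice[OF \<sigma>(1)]])
      have "real d \<le> 2 ^ d"
        using less_exp[of d] by (metis less_imp_le of_nat_le_iff of_nat_numeral of_nat_power)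
      then show "real d * (1/2) ^ (n + d) \<le> (1/2) ^ n"
        by (simp add: power_add field_simps)
    qed
    \<comment> \<open>The range of integration lies in \<open>{0..<e}\<close>, where the determinant
      vanishes almost everywhere.\<close>
    also have "\<dots> \<le> (\<Sum>\<tau>\<in>S. integral {0..(1/2) ^ n} (P \<tau>))"
    proof (rule integral_le_sum_AE)
      show "AE t in lborel. t \<in> {0..(1/2) ^ n} \<longrightarrow> P \<sigma> t \<le> (\<Sum>\<tau>\<in>S. P \<tau> t)"
        using e(2)
      proof eventually_elim
        case (elim t)
        show ?case
        proof
          assume t: "t \<in> {0..(1/2) ^ n}"
          then have "conv_det d \<Phi> t = 0"
            using elim n by auto
          then show "P \<sigma> t \<le> (\<Sum>\<tau>\<in>S. P \<tau> t)"
            unfolding S_def P_def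
            by (rule conv_det_zero_imp_le[OF _ s \<sigma>(1,2)])
              (use P_nice t in \<open>auto simp: nonneg_L1_loc_def P_def\<close>)
        qed
      qed
    qed (use P_nice \<sigma>(1) fin in \<open>auto simp: S_def\<close>)
    also have "\<dots> \<le> (\<Sum>\<tau>\<in>S. p \<tau> n)"
      unfolding p_def P_def using assms(1) nice
      by (intro sum_mono integral_conv_prod_le) (auto simp: S_def)
    finally show ?thesis .
  qed
  have "eventually (\<lambda>n. (1/2) ^ n < e) sequentially"
    using e(1) by (intro order_tendstoD[OF LIMSEQ_realpow_zero]) auto
  then have "eventually (\<lambda>n. p \<sigma> (n + d) \<le> (\<Sum>\<tau>\<in>S. p \<tau> n)) sequentially"
    by eventually_elim (rule le)
  then show False
  proof (rule ratio_limit_domination_contradiction[rotated -1])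
    show "0 < p \<sigma> n" "(\<lambda>n. p \<sigma> (Suc n) / p \<sigma> n) \<longlonglongrightarrow> (1/2) powr ((\<Sum>i\<in>{1..d}. \<alpha> i (\<sigma> i)) + real d)" for n
      using p_pos p_ratio \<sigma>(1) by blast+
    show "0 < p \<tau> n" "(\<lambda>n. p \<tau> (Suc n) / p \<tau> n) \<longlonglongrightarrow> (1/2) powr ((\<Sum>i\<in>{1..d}. \<alpha> i (\<tau> i)) + real d)"
      if "\<tau> \<in> S" for \<tau> n
      using p_pos p_ratio that unfolding S_def by blast+
    \<comment> \<open>With base 1/2 the larger exponent gives the smaller ratio limit, so the terms
      of opposite sign decay faster.\<close>
    show "(1/2 :: real) powr ((\<Sum>i\<in>{1..d}. \<alpha> i (\<tau> i)) + real d) < (1/2) powr ((\<Sum>i\<in>{1..d}. \<alpha> i (\<sigma> i)) + real d)"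
      if "\<tau> \<in> S" for \<tau>
      using exponent_less[OF that] by (intro powr_less_mono') auto
  qed simp
qed

end
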